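(* Let $H\in(0,1)$, $\lambda>0$ and $x\in\mathbb{R}$, $x\neq 0$. For $\varepsilon>0$ let $(X^{\varepsilon,H}_t(x))_{t\ge0}$ be the fractional Ornstein--Uhlenbeck process solving $\mathrm{d}X^{\varepsilon,H}_t=-\lambda X^{\varepsilon,H}_t\,\mathrm{d}t+\varepsilon\,\mathrm{d}B^H_t$, $X^{\varepsilon,H}_0=x$, where $(B^H_t)_{t\ge 0}$ is a fractional Brownian motion on $\mathbb{R}$ with Hurst exponent $H$. Put $\mathcal{R}:=\frac{\lambda^{-2H}\Gamma(2H+1)}{2}$ and let $X^{\varepsilon,H}_\infty$ be a random variable with law $\mathcal{N}(0,\varepsilon^2\mathcal{R})$ (the limiting law of $X^{\varepsilon,H}_t(x)$ as $t\to\infty$). For $\varepsilon\in(0,1)$ define $t_\varepsilon:=\frac1\lambda\ln\left(\frac1\varepsilon\right)$. Then for any $(w_\varepsilon)_{\varepsilon\in(0,1)}$ such that $w_\varepsilon\to w$ as $\varepsilon\to0^+$ with $w>0$, $$\lim_{\varepsilon\to0^+}\mathrm{d}_{\mathrm{TV}}\left(X^{\varepsilon,H}_{t_\varepsilon+r w_\varepsilon}(x),X^{\varepsilon,H}_\infty\right)=\mathcal{P}^H_{\mathrm{TV}}(r)\quad\text{for every } r\in\mathbb{R},$$ where $$\mathcal{P}^H_{\mathrm{TV}}(r):=\mathrm{d}_{\mathrm{TV}}\left(\mathcal{N}(e^{-\lambda r w}x,\mathcal{R}),\,\mathcal{N}(0,\mathcal{R})\right),\quad r\in\mathbb{R}.$$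 In addition, $\lim_{r\to-\infty}\mathcal{P}^H_{\mathrm{TV}}(r)=1$ and $\lim_{r\to\infty}\mathcal{P}^H_{\mathrm{TV}}(r)=0$.
   Context: $\mathrm{d}_{\mathrm{TV}}$ is the total variation distance between laws, $\mathrm{d}_{\mathrm{TV}}(X_1,X_2)=\sup_{B\in\mathcal{B}(\mathbb{R})}|\mathbb{P}(X_1\in B)-\mathbb{P}(X_2\in B)|$. $\mathcal{N}(a,s^2)$ is the normal law with mean $a$ and variance $s^2>0$; $\Gamma$ is the Gamma function. Fractional Brownian motion with Hurst exponent $H$ is the continuous centered Gaussian process started at $0$ with $\mathbb{E}[B^H_sB^H_t]=\frac12(t^{2H}+s^{2H}-|t-s|^{2H})$. The solution of the equation is given path-wise by $X^{\varepsilon,H}_t(x)=e^{-\lambda t}x+\varepsilon e^{-\lambda t}\int_0^t e^{\lambda s}\,\mathrm{d}B^H_s$, where the integral is defined by integration by parts: $\int_0^t e^{\lambda s}\,\mathrm{d}B^H_s=e^{\lambda t}B^H_t-\lambda\int_0^t e^{\lambda s}B^H_s\,\mathrm{d}s$. *)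

theory Defs
  imports "HOL-Probability.Probability"
begin

text \<open>The second parameter is the variance, whereas \<^const>\<open>normal_density\<close> takes the
  standard deviation; only meaningful for \<open>v > 0\<close>.\<close>

definition normal_law :: "real \<Rightarrow> real \<Rightarrow> real measure" where
  "normal_law a v = density lborel (\<lambda>y. ennreal (normal_density a (sqrt v) y))"

definition tv_dist :: "real measure \<Rightarrow> real measure \<Rightarrow> real" where
  "tv_dist \<mu> \<nu> = (SUP B\<in>sets borel. \<bar>measure \<mu> B - measure \<nu> B\<bar>)"

text \<open>Point masses count as (degenerate) Gaussian laws.\<close>

definition gaussian_law :: "real measure \<Rightarrow> bool" where
  "gaussian_law \<mu> \<longleftrightarrow> (\<exists>a. \<mu> = return borel a \<or> (\<exists>v>0. \<mu> = normal_law a v))"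

definition gaussian_process :: "'a measure \<Rightarrow> real set \<Rightarrow> (real \<Rightarrow> 'a \<Rightarrow> real) \<Rightarrow> bool" where
  "gaussian_process M T X \<longleftrightarrow>
     (\<forall>t\<in>T. X t \<in> borel_measurable M) \<and>
     (\<forall>F c. finite F \<longrightarrow> F \<subseteq> T \<longrightarrow>
        gaussian_law (distr M borel (\<lambda>\<omega>. \<Sum>t\<in>F. c t * X t \<omega>)))"

text \<open>Only the times \<open>t \<ge> 0\<close> matter. Continuity and the initial value are required
  for every \<open>\<omega>\<close>, since the equation below is solved path by path.\<close>

definition fractional_brownian_motion ::
    "'a measure \<Rightarrow> real \<Rightarrow> (real \<Rightarrow> 'a \<Rightarrow> real) \<Rightarrow> bool" where
  "fractional_brownian_motion M H B \<longleftrightarrow>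
     gaussian_process M {0..} B \<and>
     (\<forall>t\<ge>0. (\<integral>\<omega>. B t \<omega> \<partial>M) = 0) \<and>
     (\<forall>\<omega>\<in>space M. B 0 \<omega> = 0) \<and>
     (\<forall>\<omega>\<in>space M. continuous_on {0..} (\<lambda>t. B t \<omega>)) \<and>
     (\<forall>s\<ge>0. \<forall>t\<ge>0. (\<integral>\<omega>. B s \<omega> * B t \<omega> \<partial>M) =
        (t powr (2 * H) + s powr (2 * H) - \<bar>t - s\<bar> powr (2 * H)) / 2)"

text \<open>The path-wise integral of \<open>exp (lam * s)\<close> against \<open>b\<close> over \<open>{0..t}\<close>,
  defined by integration by parts (for paths with \<open>b 0 = 0\<close>).\<close>

definition exp_path_integral :: "real \<Rightarrow> (real \<Rightarrow> real) \<Rightarrow> real \<Rightarrow> real" where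
  "exp_path_integral lam b t =
     exp (lam * t) * b t - lam * integral {0..t} (\<lambda>s. exp (lam * s) * b s)"

definition fractional_OU ::
    "real \<Rightarrow> (real \<Rightarrow> 'a \<Rightarrow> real) \<Rightarrow> real \<Rightarrow> real \<Rightarrow> real \<Rightarrow> 'a \<Rightarrow> real" where
  "fractional_OU lam B x \<epsilon> t \<omega> =
     exp (- lam * t) * x + \<epsilon> * exp (- lam * t) * exp_path_integral lam (\<lambda>s. B s \<omega>) t"

definition fou_variance :: "real \<Rightarrow> real \<Rightarrow> real" where
  "fou_variance H lam = lam powr (- 2 * H) * Gamma (2 * H + 1) / 2"

definition cutoff_time :: "real \<Rightarrow> real \<Rightarrow> real" where
  "cutoff_time lam \<epsilon> = (1 / lam) * ln (1 / \<epsilon>)"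

definition tv_profile :: "real \<Rightarrow> real \<Rightarrow> real \<Rightarrow> real \<Rightarrow> real \<Rightarrow> real" where
  "tv_profile H lam x w r =
     tv_dist (normal_law (exp (- lam * r * w) * x) (fou_variance H lam))
             (normal_law 0 (fou_variance H lam))"

text \<open>The explicit formula does solve \<open>dX = - lam X dt + \<epsilon> dB\<close>, \<open>X 0 = x\<close>, path by path.\<close>

lemma fractional_OU_initial:
  "B 0 \<omega> = 0 \<Longrightarrow> fractional_OU lam B x \<epsilon> 0 \<omega> = x"
  by (simp add: fractional_OU_def exp_path_integral_def)

lemma fractional_OU_solves:
  assumes cont: "continuous_on {0..} (\<lambda>t. B t \<omega>)" and t: "t \<ge> 0"
  shows "((\<lambda>s. - lam * fractional_OU lam B x \<epsilon> s \<omega>) has_integral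
           (fractional_OU lam B x \<epsilon> t \<omega> - x - \<epsilon> * B t \<omega>)) {0..t}"
proof -
  define J where "J = (\<lambda>u. integral {0..u} (\<lambda>s. exp (lam * s) * B s \<omega>))"
  define Y where "Y = (\<lambda>u. exp (- lam * u) * (x - \<epsilon> * lam * J u))"
  have X: "fractional_OU lam B x \<epsilon> s \<omega> = Y s + \<epsilon> * B s \<omega>" for s
    by (simp add: fractional_OU_def exp_path_integral_def Y_def J_def algebra_simps
          flip: exp_add)
  have c: "continuous_on {0..t} (\<lambda>s. exp (lam * s) * B s \<omega>)"
    by (intro continuous_intros continuous_on_subset[OF cont]) auto
  have J: "(J has_real_derivative exp (lam * s) * B s \<omega>) (at s within {0..t})"
    if "s \<in> {0..t}" for s
    unfolding J_def by (rule integral_has_real_derivative[OF c that])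
  have Y: "(Y has_vector_derivative - lam * fractional_OU lam B x \<epsilon> s \<omega>) (at s within {0..t})"
    if "s \<in> {0..t}" for s
  proof -
    have "(Y has_real_derivative
            exp (- lam * s) * (- lam) * (x - \<epsilon> * lam * J s)
            + exp (- lam * s) * (- (\<epsilon> * lam * (exp (lam * s) * B s \<omega>)))) (at s within {0..t})"
      unfolding Y_def by (auto intro!: derivative_eq_intros J[OF that])
    also have "exp (- lam * s) * (- lam) * (x - \<epsilon> * lam * J s)
            + exp (- lam * s) * (- (\<epsilon> * lam * (exp (lam * s) * B s \<omega>)))
          = - lam * fractional_OU lam B x \<epsilon> s \<omega>"
      unfolding X Y_def by (simp add: algebra_simps flip: exp_add)
    finally show ?thesis by (simp add: has_real_derivative_iff_has_vector_derivative)
  qed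
  have "((\<lambda>s. - lam * fractional_OU lam B x \<epsilon> s \<omega>) has_integral (Y t - Y 0)) {0..t}"
    by (rule fundamental_theorem_of_calculus[OF t Y])
  moreover have "Y 0 = x" by (simp add: Y_def J_def)
  ultimately show ?thesis by (simp add: X)
qed

end

theory Submission
  imports Defs "HOL-Real_Asymp.Real_Asymp"
begin

text \<open>The noise \<open>Z\<^sub>t = B\<^sub>t - exp (- lam * t) * (\<integral>\<^sub>0\<^sup>t lam * exp (lam * s) * B\<^sub>s ds)\<close>
  is a path-wise limit of Riemann sums, which are centered Gaussian with variances converging to a
  double integral of the covariance; by dominated convergence for characteristic functions \<open>Z\<^sub>t\<close>
  is Gaussian with that variance. Integrating by parts reduces the variance to one-dimensional integrals which converge,
  as \<open>t \<rightarrow> \<infinity>\<close>, to a Gamma integral. Since total variation is invariant under scaling and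
  \<open>exp (- lam * t\<^sub>\<epsilon>) = \<epsilon>\<close>, dividing by \<open>\<epsilon>\<close> turns the distance at time \<open>t\<^sub>\<epsilon> + r * w\<^sub>\<epsilon>\<close> into
  the distance between normal laws with converging parameters, so the claim follows from the
  continuity of the total variation distance in these parameters (Scheffe's argument).\<close>

section \<open>Total variation distance of normal laws\<close>

lemma abs_prob_diff_le_1:
  assumes "prob_space \<mu>" "prob_space \<nu>"
  shows "\<bar>measure \<mu> A - measure \<nu> B\<bar> \<le> 1"
  using prob_space.prob_le_1[OF assms(1), of A] prob_space.prob_le_1[OF assms(2), of B]
    measure_nonneg[of \<mu> A] measure_nonneg[of \<nu> B] by linarith

lemma tv_dist_bdd_above:
  fixes \<mu> \<nu> :: "real measure"
  assumes "prob_space \<mu>" "prob_space \<nu>"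
  shows "bdd_above ((\<lambda>B. \<bar>measure \<mu> B - measure \<nu> B\<bar>) ` sets borel)"
  by (rule bdd_aboveI2) (rule abs_prob_diff_le_1[OF assms])

lemma tv_dist_upper:
  assumes "prob_space \<mu>" "prob_space \<nu>" "B \<in> sets borel"
  shows "\<bar>measure \<mu> B - measure \<nu> B\<bar> \<le> tv_dist \<mu> \<nu>"
  unfolding tv_dist_def by (rule cSUP_upper[OF assms(3) tv_dist_bdd_above[OF assms(1,2)]])

lemma tv_dist_least:
  assumes "\<And>B. B \<in> sets borel \<Longrightarrow> \<bar>measure \<mu> B - measure \<nu> B\<bar> \<le> c"
  shows "tv_dist \<mu> \<nu> \<le> c"
  unfolding tv_dist_def by (rule cSUP_least) (use assms in auto)

lemma tv_dist_nonneg: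
  assumes "prob_space \<mu>" "prob_space \<nu>"
  shows "0 \<le> tv_dist \<mu> \<nu>"
  using tv_dist_upper[OF assms, of "{}"] by simp

lemma tv_dist_le_1:
  assumes "prob_space \<mu>" "prob_space \<nu>"
  shows "tv_dist \<mu> \<nu> \<le> 1"
  by (rule tv_dist_least) (rule abs_prob_diff_le_1[OF assms])

lemma tv_dist_self [simp]: "tv_dist \<mu> \<mu> = 0"
proof -
  have "sets borel \<noteq> ({} :: real set set)" by (metis empty_iff sets.empty_sets)
  then show ?thesis by (simp add: tv_dist_def)
qed

lemma tv_dist_commute: "tv_dist \<mu> \<nu> = tv_dist \<nu> \<mu>"
  unfolding tv_dist_def by (simp add: abs_minus_commute)

lemma tv_dist_triangle:
  assumes "prob_space \<mu>" "prob_space \<nu>" "prob_space \<rho>"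
  shows "tv_dist \<mu> \<rho> \<le> tv_dist \<mu> \<nu> + tv_dist \<nu> \<rho>"
proof (rule tv_dist_least)
  fix B :: "real set" assume "B \<in> sets borel"
  then show "\<bar>measure \<mu> B - measure \<rho> B\<bar> \<le> tv_dist \<mu> \<nu> + tv_dist \<nu> \<rho>"
    using tv_dist_upper[OF assms(1,2), of B] tv_dist_upper[OF assms(2,3), of B] by linarith
qed

text \<open>For \<open>c \<noteq> 0\<close>, taking preimages under multiplication by
  \<open>c\<close> permutes the Borel sets, so both suprema run over the same set of values. This is
  what removes the common factor \<open>\<epsilon>\<close> from the process and its limit
  law.\<close>

lemma tv_dist_scale:
  fixes \<mu> \<nu> :: "real measure"
  assumes c: "c \<noteq> 0" and [measurable_cong]: "sets \<mu> = sets borel" "sets \<nu> = sets borel"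
  shows "tv_dist (distr \<mu> borel (\<lambda>y. c * y)) (distr \<nu> borel (\<lambda>y. c * y)) = tv_dist \<mu> \<nu>"
proof -
  have sp: "space \<mu> = UNIV" "space \<nu> = UNIV"
    using assms(2,3)[THEN sets_eq_imp_space_eq] by simp_all
  let ?d = "\<lambda>B. \<bar>measure \<mu> B - measure \<nu> B\<bar>"
  have "(\<lambda>B. \<bar>measure (distr \<mu> borel (\<lambda>y. c * y)) B - measure (distr \<nu> borel (\<lambda>y. c * y)) B\<bar>) ` sets borel
      = (\<lambda>B. ?d ((\<lambda>y. c * y) -` B)) ` sets borel"
    by (intro image_cong refl) (simp add: measure_distr sp)
  also have "\<dots> = ?d ` sets borel"
  proof (intro equalityI image_subsetI)
    fix B :: "real set" assume B: "B \<in> sets borel"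
    have "(\<lambda>y. c * y) -` B \<in> sets borel"
      using measurable_sets_borel[of "\<lambda>y. c * y" borel B] B by simp
    then show "?d ((\<lambda>y. c * y) -` B) \<in> ?d ` sets borel" by (rule imageI)
    \<comment> \<open>Surjectivity of the permutation: the set mapped to \<open>B\<close> is its
      preimage under division by \<open>c\<close>.\<close>
    have "(\<lambda>y. y / c) -` B \<in> sets borel"
      using measurable_sets_borel[of "\<lambda>y. y / c" borel B] B by simp
    moreover have "B = (\<lambda>y. c * y) -` ((\<lambda>y. y / c) -` B)"
      using c by (auto simp: vimage_def)
    ultimately show "?d B \<in> (\<lambda>B. ?d ((\<lambda>y. c * y) -` B)) ` sets borel"
      by (metis (no_types, lifting) imageI)
  qed
  finally show ?thesis unfolding tv_dist_def by simp
qed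

section \<open>Normal laws and the dependence of their distance on the parameters\<close>

lemma prob_space_normal_law: "0 < v \<Longrightarrow> prob_space (normal_law a v)"
  unfolding normal_law_def by (rule prob_space_normal_density) simp

lemma sets_normal_law [simp, measurable_cong]: "sets (normal_law a v) = sets borel"
  by (simp add: normal_law_def)

lemma measure_normal_law:
  assumes v: "0 < v" and B [measurable]: "B \<in> sets borel"
  shows "measure (normal_law a v) B = (\<integral>y. normal_density a (sqrt v) y * indicator B y \<partial>lborel)"
proof -
  interpret prob_space "normal_law a v" by (rule prob_space_normal_law) fact
  have "measure (normal_law a v) B = (\<integral>y. indicator B y \<partial>normal_law a v)"
    by simp
  also have "\<dots> = (\<integral>y. normal_density a (sqrt v) y * indicator B y \<partial>lborel)"
    unfolding normal_law_def by (subst integral_density) auto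
  finally show ?thesis .
qed

text \<open>Phrased for a random variable on any probability space: with \<open>X\<close> the
  identity it shifts and rescales normal laws themselves, and with \<open>X\<close> the noise it
  gives the law of the process.\<close>

lemma normal_law_affine:
  assumes X: "X \<in> borel_measurable M" and M: "prob_space M" and v: "0 < v" and c: "c \<noteq> 0"
    and law: "distr M borel X = normal_law a v"
  shows "distr M borel (\<lambda>\<omega>. b + c * X \<omega>) = normal_law (b + c * a) (c\<^sup>2 * v)"
proof -
  interpret prob_space M by fact
  have "distributed M lborel X (normal_density a (sqrt v))"
    using X law unfolding distributed_def normal_law_def
    by (simp cong: distr_cong)
  from normal_density_affine[OF this, of c b] v c
  have "distributed M lborel (\<lambda>\<omega>. b + c * X \<omega>) (normal_density (b + c * a) (\<bar>c\<bar> * sqrt v))"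
    by simp
  then show ?thesis
    unfolding distributed_def normal_law_def
    by (simp add: real_sqrt_mult cong: distr_cong)
qed

text \<open>On any set the difference of the masses is at most the integral of the positive part of
  the difference of the densities. The positive part is preferred to the absolute value because it
  is dominated by the first density alone.\<close>

lemma tv_dist_normal_le:
  assumes v: "0 < v" "0 < v'"
  shows "tv_dist (normal_law a v) (normal_law a' v')
    \<le> (\<integral>y. max 0 (normal_density a (sqrt v) y - normal_density a' (sqrt v') y) \<partial>lborel)"
proof (rule tv_dist_least)
  let ?f = "normal_density a (sqrt v)" and ?g = "normal_density a' (sqrt v')"
  let ?D = "\<integral>y. max 0 (?f y - ?g y) \<partial>lborel"
  have int: "integrable lborel ?f" "integrable lborel ?g"
    using v by auto
  have le: "measure (normal_law a v) B - measure (normal_law a' v') B \<le> ?D"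
    if [measurable]: "B \<in> sets borel" for B
  proof -
    have i: "integrable lborel (\<lambda>y. ?f y * indicator B y)" "integrable lborel (\<lambda>y. ?g y * indicator B y)"
      using int by (auto intro!: integrable_real_mult_indicator)
    have "measure (normal_law a v) B - measure (normal_law a' v') B
        = (\<integral>y. ?f y * indicator B y - ?g y * indicator B y \<partial>lborel)"
      using v i by (simp add: measure_normal_law)
    also have "\<dots> \<le> ?D"
      using i int by (intro integral_mono) (auto simp: indicator_def)
    finally show ?thesis .
  qed
  fix B :: "real set" assume B: "B \<in> sets borel"
  interpret P: prob_space "normal_law a v" by (rule prob_space_normal_law) fact
  interpret Q: prob_space "normal_law a' v'" by (rule prob_space_normal_law) fact
  have sp: "space (normal_law a v) = UNIV" for a v
    by (simp add: normal_law_def)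
  \<comment> \<open>Both laws have mass one, so passing to \<open>- B\<close> flips the sign of the
    difference; the one-sided bound for \<open>B\<close> and \<open>- B\<close> therefore controls
    the absolute value.\<close>
  show "\<bar>measure (normal_law a v) B - measure (normal_law a' v') B\<bar> \<le> ?D"
    using le[OF B] le[of "- B"] B P.prob_compl[of B] Q.prob_compl[of B]
    by (simp add: sp Compl_eq_Diff_UNIV)
qed

text \<open>Scheffe's argument: the densities converge pointwise, and the positive part of limit
  density minus approximating density is dominated by the limit density, which is fixed and
  integrable. Hence the limit law stands in the first argument.\<close>

lemma tv_dist_normal_tendsto_0:
  fixes a v :: "nat \<Rightarrow> real"
  assumes v: "v \<longlonglongrightarrow> v0" and a: "a \<longlonglongrightarrow> a0" and v0: "0 < v0"
  shows "(\<lambda>n. tv_dist (normal_law a0 v0) (normal_law (a n) (v n))) \<longlonglongrightarrow> 0"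
proof -
  let ?f = "normal_density a0 (sqrt v0)" and ?g = "\<lambda>n. normal_density (a n) (sqrt (v n))"
  have "(\<lambda>n. \<integral>y. max 0 (?f y - ?g n y) \<partial>lborel) \<longlonglongrightarrow> (\<integral>y. 0 \<partial>(lborel :: real measure))"
  proof (rule integral_dominated_convergence)
    show "integrable lborel ?f" using v0 by simp
    show "AE y in lborel. norm (max 0 (?f y - ?g n y)) \<le> ?f y" for n
      by (simp add: max_def)
    show "AE y in lborel. (\<lambda>n. max 0 (?f y - ?g n y)) \<longlonglongrightarrow> 0"
    proof (rule AE_I2)
      fix y
      have "(\<lambda>n. ?g n y) \<longlonglongrightarrow> ?f y"
        unfolding normal_density_def using v0 by (intro tendsto_intros v a) auto
      then have "(\<lambda>n. max 0 (?f y - ?g n y)) \<longlonglongrightarrow> max 0 (?f y - ?f y)"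
        by (intro tendsto_intros)
      then show "(\<lambda>n. max 0 (?f y - ?g n y)) \<longlonglongrightarrow> 0" by simp
    qed
  qed simp_all
  then have lim: "(\<lambda>n. \<integral>y. max 0 (?f y - ?g n y) \<partial>lborel) \<longlonglongrightarrow> 0" by simp
  have ev: "\<forall>\<^sub>F n in sequentially. 0 < v n"
    using order_tendstoD(1)[OF v v0] .
  show ?thesis
    by (rule tendsto_sandwich[OF _ _ tendsto_const lim])
       (use ev v0 in \<open>auto elim!: eventually_mono
          intro!: tv_dist_nonneg tv_dist_normal_le prob_space_normal_law\<close>)
qed

text \<open>By the triangle inequality the two distances to \<open>normal_law b u\<close> differ by
  at most the distance between the two varying laws, which tends to 0. Dominated convergence works
  along sequences; continuity at a pair of parameters then carries the result over to arbitrary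
  filters.\<close>

lemma isCont_tv_dist_normal:
  assumes v: "0 < v" and u: "0 < u"
  shows "isCont (\<lambda>p. tv_dist (normal_law (fst p) (snd p)) (normal_law b u)) (a, v)"
  unfolding continuous_at_sequentially
proof (intro allI impI)
  fix X :: "nat \<Rightarrow> real \<times> real" assume X: "X \<longlonglongrightarrow> (a, v)"
  let ?T = "\<lambda>a v. tv_dist (normal_law a v) (normal_law b u)"
  have lim: "(\<lambda>n. fst (X n)) \<longlonglongrightarrow> a" "(\<lambda>n. snd (X n)) \<longlonglongrightarrow> v"
    using tendsto_fst[OF X] tendsto_snd[OF X] by simp_all
  note 0 = tv_dist_normal_tendsto_0[OF lim(2,1) v]
  have "\<forall>\<^sub>F n in sequentially. dist (?T (fst (X n)) (snd (X n))) (?T a v)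
      \<le> tv_dist (normal_law a v) (normal_law (fst (X n)) (snd (X n)))"
    using order_tendstoD(1)[OF lim(2) v]
  proof eventually_elim
    case (elim n)
    let ?P = "normal_law (fst (X n)) (snd (X n))"
    have "?T (fst (X n)) (snd (X n)) \<le> tv_dist ?P (normal_law a v) + ?T a v"
      "?T a v \<le> tv_dist (normal_law a v) ?P + ?T (fst (X n)) (snd (X n))"
      using elim u v by (auto intro!: tv_dist_triangle prob_space_normal_law)
    then show ?case
      by (simp add: dist_real_def tv_dist_commute[of ?P])
  qed
  from tendsto_sandwich[OF _ this tendsto_const 0]
  have "(\<lambda>n. dist (?T (fst (X n)) (snd (X n))) (?T a v)) \<longlonglongrightarrow> 0" by simp
  then show "((\<lambda>p. ?T (fst p) (snd p)) \<circ> X) \<longlonglongrightarrow> ?T (fst (a, v)) (snd (a, v))"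
    by (simp add: o_def tendsto_dist_iff[symmetric])
qed

lemma tv_dist_normal_tendsto:
  assumes "(a \<longlongrightarrow> a0) F" "(v \<longlongrightarrow> v0) F" "0 < v0" "0 < u"
  shows "((\<lambda>i. tv_dist (normal_law (a i) (v i)) (normal_law b u))
           \<longlongrightarrow> tv_dist (normal_law a0 v0) (normal_law b u)) F"
  using isCont_tendsto_compose[OF isCont_tv_dist_normal[OF assms(3,4)] tendsto_Pair[OF assms(1,2)]]
  by simp

text \<open>The centered interval of radius \<open>\<bar>a i\<bar> / 3\<close> separates the laws:
  the centered law gives it mass \<open>q (\<bar>a i\<bar> / 3)\<close>, and the shifted law at most
  the complementary mass. The distance is thus at least
  \<open>2 * q (\<bar>a i\<bar> / 3) - 1\<close>, and \<open>q\<close> tends to 1.\<close>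

lemma tv_dist_normal_tendsto_1:
  fixes a :: "'i \<Rightarrow> real"
  assumes a: "filterlim (\<lambda>i. \<bar>a i\<bar>) at_top F" and v: "0 < v"
  shows "((\<lambda>i. tv_dist (normal_law (a i) v) (normal_law 0 v)) \<longlongrightarrow> 1) F"
proof -
  interpret P: prob_space "normal_law 0 v" by (rule prob_space_normal_law) fact
  have sp: "space (normal_law 0 v) = UNIV"
    by (simp add: normal_law_def)
  let ?N = "normal_law 0 v"
  define q where "q r = measure ?N {- r..r}" for r :: real
  have "(\<lambda>n. measure ?N {- real n..real n}) \<longlonglongrightarrow> measure ?N (\<Union>n. {- real n..real n})"
    by (rule P.finite_Lim_measure_incseq) (auto simp: incseq_def)
  also have "(\<Union>n. {- real n..real n}) = UNIV"
  proof (intro equalityI subsetI UNIV_I)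
    fix y :: real
    obtain n where "\<bar>y\<bar> \<le> real n" using real_arch_simple by blast
    then show "y \<in> (\<Union>n. {- real n..real n})" by (intro UN_I[of n]) auto
  qed
  finally have qn: "(\<lambda>n. q (real n)) \<longlonglongrightarrow> 1"
    using P.prob_space by (simp add: q_def sp)
  have q_mono: "q r \<le> q s" if "r \<le> s" for r s
    unfolding q_def using that by (intro P.finite_measure_mono) auto
  have q_le: "q r \<le> 1" for r
    unfolding q_def by simp
  \<comment> \<open>Monotonicity of \<open>q\<close> extends its limit from integer radii to real
    ones.\<close>
  have q: "(q \<longlongrightarrow> 1) at_top"
  proof (rule order_tendstoI)
    fix e :: real assume "e < 1"
    from order_tendstoD(1)[OF qn this] obtain n where "e < q (real n)"
      by (auto simp: eventually_sequentially)
    then show "\<forall>\<^sub>F r in at_top. e < q r"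
      using q_mono by (intro eventually_mono[OF eventually_ge_at_top[of "real n"]]) (rule less_le_trans)
  next
    fix e :: real assume "1 < e"
    then show "\<forall>\<^sub>F r in at_top. q r < e"
      by (intro always_eventually allI le_less_trans[OF q_le])
  qed
  have low: "2 * q (\<bar>a i\<bar> / 3) - 1 \<le> tv_dist (normal_law (a i) v) ?N" if i: "0 < \<bar>a i\<bar>" for i
  proof -
    interpret Q: prob_space "normal_law (a i) v" by (rule prob_space_normal_law) fact
    let ?B = "{- (\<bar>a i\<bar> / 3)..\<bar>a i\<bar> / 3}"
    have shift: "distr ?N borel (\<lambda>y. a i + 1 * y) = normal_law (a i + 1 * 0) (1\<^sup>2 * v)"
      by (rule normal_law_affine)
         (use v in \<open>auto intro!: prob_space_normal_law distr_id2 simp: measurable_ident_sets\<close>)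
    have "measure (normal_law (a i) v) ?B = measure (distr ?N borel (\<lambda>y. a i + 1 * y)) ?B"
      unfolding shift by simp
    also have "\<dots> = measure ?N {y. a i + y \<in> ?B}"
      by (subst measure_distr) (auto simp: sp vimage_def)
    also have "\<dots> \<le> measure ?N (UNIV - ?B)"
    proof (rule P.finite_measure_mono)
      \<comment> \<open>If \<open>a i + y\<close> lies within \<open>\<bar>a i\<bar> / 3\<close> of
        0, then \<open>\<bar>y\<bar>\<close> is at least \<open>2 * \<bar>a i\<bar> / 3\<close>,
        which exceeds the radius because \<open>a i\<close> is nonzero.\<close>
      show "{y. a i + y \<in> ?B} \<subseteq> UNIV - ?B" using i by auto
    qed simp
    also have "\<dots> = 1 - q (\<bar>a i\<bar> / 3)"
      using P.prob_compl[of ?B] by (simp add: sp q_def)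
    finally have "measure (normal_law (a i) v) ?B \<le> 1 - q (\<bar>a i\<bar> / 3)" .
    moreover have "\<bar>measure (normal_law (a i) v) ?B - measure ?N ?B\<bar> \<le> tv_dist (normal_law (a i) v) ?N"
      by (rule tv_dist_upper) (auto intro: P.prob_space_axioms Q.prob_space_axioms)
    ultimately show ?thesis unfolding q_def by linarith
  qed
  show ?thesis
  proof (rule tendsto_sandwich)
    have "filterlim (\<lambda>i. (1/3) * \<bar>a i\<bar>) at_top F"
      by (rule filterlim_tendsto_pos_mult_at_top[OF tendsto_const _ a]) simp
    from filterlim_compose[OF q this]
    have "((\<lambda>i. 2 * q (\<bar>a i\<bar> / 3) - 1) \<longlongrightarrow> 2 * 1 - 1) F"
      by (intro tendsto_intros) simp
    then show "((\<lambda>i. 2 * q (\<bar>a i\<bar> / 3) - 1) \<longlongrightarrow> 1) F" by simp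
    have "\<forall>\<^sub>F i in F. 0 < \<bar>a i\<bar>"
      using a by (rule filterlim_at_top_dense[THEN iffD1, THEN spec])
    then show "\<forall>\<^sub>F i in F. 2 * q (\<bar>a i\<bar> / 3) - 1 \<le> tv_dist (normal_law (a i) v) ?N"
      by eventually_elim (rule low)
    show "\<forall>\<^sub>F i in F. tv_dist (normal_law (a i) v) ?N \<le> 1"
      using v by (auto intro!: always_eventually tv_dist_le_1 prob_space_normal_law)
  qed simp
qed

section \<open>Riemann sums\<close>

text \<open>Rounding the argument down to the grid of mesh \<open>h\<close> makes a left-endpoint
  Riemann sum an exact integral, so that convergence of Riemann sums becomes a matter of dominated
  convergence.\<close>

lemma has_integral_floor_step:
  fixes g :: "real \<Rightarrow> real" and h :: real
  assumes h: "0 < h"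
  shows "((\<lambda>s. g (h * of_int \<lfloor>s / h\<rfloor>)) has_integral h * (\<Sum>k<n. g (h * real k))) {0..h * real n}"
proof (induction n)
  case (Suc n)
  have "((\<lambda>s. g (h * real n)) has_integral (h * real (Suc n) - h * real n) *\<^sub>R g (h * real n))
          {h * real n..h * real (Suc n)}"
    using h by (intro has_integral_const_real[THEN has_integral_eq_rhs]) (auto simp: algebra_simps)
  \<comment> \<open>The floor already jumps at the right end of the cell; this single point is
    discarded as a finite exceptional set.\<close>
  moreover have "g (h * of_int \<lfloor>s / h\<rfloor>) = g (h * real n)"
    if "s \<in> {h * real n..h * real (Suc n)} - {h * real (Suc n)}" for s
  proof -
    have "\<lfloor>s / h\<rfloor> = int n"
      using that h by (intro floor_unique) (auto simp: field_simps)
    then show ?thesis by simp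
  qed
  ultimately have "((\<lambda>s. g (h * of_int \<lfloor>s / h\<rfloor>)) has_integral
      (h * real (Suc n) - h * real n) *\<^sub>R g (h * real n)) {h * real n..h * real (Suc n)}"
    by (rule has_integral_spike_finite[OF finite.insertI[OF finite.emptyI], rotated])
  from has_integral_combine[OF _ _ Suc.IH this]
  have "((\<lambda>s. g (h * of_int \<lfloor>s / h\<rfloor>)) has_integral h * (\<Sum>k<n. g (h * real k)) +
      (h * real (Suc n) - h * real n) *\<^sub>R g (h * real n)) {0..h * real (Suc n)}"
    using h by simp
  also have "h * (\<Sum>k<n. g (h * real k)) + (h * real (Suc n) - h * real n) *\<^sub>R g (h * real n)
      = h * (\<Sum>k<Suc n. g (h * real k))"
    by (simp add: algebra_simps)
  finally show ?case .
qed auto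

lemma floor_step_bounds:
  fixes h s :: real
  assumes "0 < h" "0 \<le> s"
  shows "0 \<le> h * of_int \<lfloor>s / h\<rfloor>" "h * of_int \<lfloor>s / h\<rfloor> \<le> s" "s - h \<le> h * of_int \<lfloor>s / h\<rfloor>"
proof -
  have "of_int \<lfloor>s / h\<rfloor> \<le> s / h" "s / h \<le> of_int \<lfloor>s / h\<rfloor> + 1"
    by linarith+
  from this[THEN mult_left_mono, of h] assms
  show "h * of_int \<lfloor>s / h\<rfloor> \<le> s" "s - h \<le> h * of_int \<lfloor>s / h\<rfloor>"
    by (simp_all add: distrib_left)
qed (use assms in simp)

lemma floor_step_tendsto:
  fixes t s :: real
  assumes "0 < t" "0 \<le> s"
  shows "(\<lambda>n. t / real (Suc n) * of_int \<lfloor>s / (t / real (Suc n))\<rfloor>) \<longlonglongrightarrow> s"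
proof (rule tendsto_sandwich)
  show "(\<lambda>n. s - t / real (Suc n)) \<longlonglongrightarrow> s"
    by real_asymp
  show "(\<lambda>n. s) \<longlonglongrightarrow> s" by simp
qed (use assms in \<open>intro always_eventually allI floor_step_bounds; simp\<close>)+

lemma floor_step_in_interval:
  fixes t s :: real
  assumes "0 < t" "s \<in> {0..t}"
  shows "t / real (Suc n) * of_int \<lfloor>s / (t / real (Suc n))\<rfloor> \<in> {0..t}"
  using assms floor_step_bounds(1,2)[of "t / real (Suc n)" s] by (simp del: of_nat_Suc)

lemma has_integral_floor_step_interval:
  fixes g :: "real \<Rightarrow> real" and t :: real
  assumes "0 < t"
  shows "((\<lambda>s. g (t / real (Suc n) * of_int \<lfloor>s / (t / real (Suc n))\<rfloor>)) has_integral
           t / real (Suc n) * (\<Sum>k<Suc n. g (t / real (Suc n) * real k))) {0..t}"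
  using has_integral_floor_step[of "t / real (Suc n)" g "Suc n"] assms by (simp del: of_nat_Suc)

lemma continuous_on_compact_bounded:
  fixes f :: "'a::metric_space \<Rightarrow> real"
  assumes "continuous_on S f" "compact S"
  obtains C where "\<And>x. x \<in> S \<Longrightarrow> norm (f x) \<le> C"
  using compact_imp_bounded[OF compact_continuous_image[OF assms]]
  by (auto simp: bounded_iff)

text \<open>The rounded points \<open>p n s\<close> tend to \<open>s\<close> and stay in the
  interval, where \<open>g\<close> is continuous and bounded, so the step integrals converge by
  dominated convergence. The mesh is \<open>t / real (Suc n)\<close>, so the cells fill
  \<open>{0..t}\<close> exactly and the denominator never vanishes.\<close>

lemma riemann_sum_tendsto_integral:
  fixes g :: "real \<Rightarrow> real" and t :: real
  assumes t: "0 < t" and g: "continuous_on {0..t} g"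
  shows "(\<lambda>n. t / real (Suc n) * (\<Sum>k<Suc n. g (t / real (Suc n) * real k))) \<longlonglongrightarrow> integral {0..t} g"
proof -
  define p where "p n s = t / real (Suc n) * of_int \<lfloor>s / (t / real (Suc n))\<rfloor>" for n s
  obtain C where C: "\<And>s. s \<in> {0..t} \<Longrightarrow> norm (g s) \<le> C"
    using continuous_on_compact_bounded[OF g compact_Icc] by blast
  have int: "((\<lambda>s. g (p n s)) has_integral
      t / real (Suc n) * (\<Sum>k<Suc n. g (t / real (Suc n) * real k))) {0..t}" for n
    unfolding p_def by (rule has_integral_floor_step_interval[OF t])
  have p: "p n s \<in> {0..t}" if "s \<in> {0..t}" for n s
    unfolding p_def using floor_step_in_interval[OF t that] .
  have "(\<lambda>n. integral {0..t} (\<lambda>s. g (p n s))) \<longlonglongrightarrow> integral {0..t} g"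
  proof (rule dominated_convergence(2))
    show "(\<lambda>s. g (p n s)) integrable_on {0..t}" for n using int by blast
    show "(\<lambda>_. C) integrable_on {0..t}" by (simp add: integrable_const_ivl)
    show "norm (g (p n s)) \<le> C" if "s \<in> {0..t}" for n s using C[OF p[OF that]] .
    show "(\<lambda>n. g (p n s)) \<longlonglongrightarrow> g s" if s: "s \<in> {0..t}" for s
      by (rule continuous_on_tendsto_compose[OF g])
         (use s p[OF s] floor_step_tendsto[OF t, of s] in \<open>auto simp: p_def\<close>)
  qed
  then show ?thesis unfolding integral_unique[OF int] .
qed

text \<open>Dominated convergence is applied twice to the iterated step integral: inside with bound
  \<open>C\<close>, outside with bound \<open>C * t\<close>.\<close>

lemma riemann_sum_tendsto_integral2:
  fixes k :: "real \<times> real \<Rightarrow> real" and t :: real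
  assumes t: "0 < t" and k: "continuous_on ({0..t} \<times> {0..t}) k"
  shows "(\<lambda>n. t / real (Suc n) * (\<Sum>i<Suc n. t / real (Suc n) *
            (\<Sum>j<Suc n. k (t / real (Suc n) * real i, t / real (Suc n) * real j))))
         \<longlonglongrightarrow> integral {0..t} (\<lambda>s. integral {0..t} (\<lambda>u. k (s, u)))"
proof -
  define p where "p n s = t / real (Suc n) * of_int \<lfloor>s / (t / real (Suc n))\<rfloor>" for n s
  define G where "G n s = t / real (Suc n) * (\<Sum>j<Suc n. k (s, t / real (Suc n) * real j))" for n s
  obtain C where C: "\<And>z. z \<in> {0..t} \<times> {0..t} \<Longrightarrow> norm (k z) \<le> C"
    using continuous_on_compact_bounded[OF k] compact_Times[OF compact_Icc compact_Icc] by blast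
  have p: "p n s \<in> {0..t}" if "s \<in> {0..t}" for n s
    unfolding p_def using floor_step_in_interval[OF t that] .
  have plim: "(\<lambda>n. p n s) \<longlonglongrightarrow> s" if "s \<in> {0..t}" for s
    unfolding p_def using floor_step_tendsto[OF t] that by auto
  have G: "((\<lambda>u. k (s, p n u)) has_integral G n s) {0..t}" for n s
    unfolding p_def G_def by (rule has_integral_floor_step_interval[OF t])
  have int: "((\<lambda>s. G n (p n s)) has_integral
      t / real (Suc n) * (\<Sum>i<Suc n. G n (t / real (Suc n) * real i))) {0..t}" for n
    unfolding p_def by (rule has_integral_floor_step_interval[OF t])
  have "(\<lambda>n. integral {0..t} (\<lambda>s. G n (p n s)))
      \<longlonglongrightarrow> integral {0..t} (\<lambda>s. integral {0..t} (\<lambda>u. k (s, u)))"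
  proof (rule dominated_convergence(2))
    show "(\<lambda>s. G n (p n s)) integrable_on {0..t}" for n using int by blast
    show "(\<lambda>_. C * t) integrable_on {0..t}" by (simp add: integrable_const_ivl)
    show "norm (G n (p n s)) \<le> C * t" if s: "s \<in> {0..t}" for n s
    proof -
      have "norm (k (t, t)) \<le> C" using C t by simp
      then have "0 \<le> C" using norm_ge_zero order_trans by blast
      moreover have "norm (k (p n s, p n u)) \<le> C" if "u \<in> {0..t} - {}" for u
        using C p[OF s] p[of u] that by simp
      ultimately have "norm (G n (p n s)) \<le> C * measure lborel {0..t}"
        by (intro has_integral_bound_real[OF _ finite.emptyI G[of "p n s" n]])
      then show ?thesis using t by simp
    qed
    show "(\<lambda>n. G n (p n s)) \<longlonglongrightarrow> integral {0..t} (\<lambda>u. k (s, u))" if s: "s \<in> {0..t}" for s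
    proof -
      \<comment> \<open>Both coordinates are rounded with the same \<open>n\<close>, so this limit
        is along a diagonal and rests on the joint continuity of \<open>k\<close>.\<close>
      have "(\<lambda>n. integral {0..t} (\<lambda>u. k (p n s, p n u))) \<longlonglongrightarrow> integral {0..t} (\<lambda>u. k (s, u))"
      proof (rule dominated_convergence(2))
        show "(\<lambda>u. k (p n s, p n u)) integrable_on {0..t}" for n using G by blast
        show "(\<lambda>_. C) integrable_on {0..t}" by (simp add: integrable_const_ivl)
        show "norm (k (p n s, p n u)) \<le> C" if "u \<in> {0..t}" for n u
          using C p[OF s] p[OF that] by auto
        show "(\<lambda>n. k (p n s, p n u)) \<longlonglongrightarrow> k (s, u)" if u: "u \<in> {0..t}" for u
          by (rule continuous_on_tendsto_compose[OF k])
             (use s u p[OF s] p[OF u] in \<open>auto intro!: tendsto_Pair plim always_eventually\<close>)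
      qed
      then show ?thesis unfolding integral_unique[OF G] .
    qed
  qed
  then show ?thesis unfolding integral_unique[OF int] by (simp only: G_def)
qed

lemma antiderivative_real:
  fixes f :: "real \<Rightarrow> real"
  assumes "continuous_on UNIV f"
  obtains F where "F 0 = 0" "\<And>x. (F has_real_derivative f x) (at x)"
proof -
  obtain F where F: "\<And>x. (F has_vector_derivative f x) (at x)"
    using einterval_antiderivative[of "-\<infinity>" "\<infinity>" f] assms
    by (auto simp: continuous_on_eq_continuous_at)
  show ?thesis
  proof (rule that[of "\<lambda>x. F x - F 0"])
    show "((\<lambda>x. F x - F 0) has_real_derivative f x) (at x)" for x
      using F[of x] by (auto simp: has_real_derivative_iff_has_vector_derivative[symmetric]
          intro!: derivative_eq_intros)
  qed simp
qed

section \<open>Variance of the Ornstein--Uhlenbeck noise\<close>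

definition fbm_cov :: "real \<Rightarrow> real \<Rightarrow> real \<Rightarrow> real" where
  "fbm_cov H s t = (t powr (2 * H) + s powr (2 * H) - \<bar>t - s\<bar> powr (2 * H)) / 2"

text \<open>The variance of \<open>B\<^sub>t - exp (- lam * t) * (\<integral>\<^sub>0\<^sup>t lam * exp (lam * s) * B\<^sub>s ds)\<close>.\<close>

definition fou_var_at :: "real \<Rightarrow> real \<Rightarrow> real \<Rightarrow> real" where
  "fou_var_at H lam t =
     fbm_cov H t t
     - 2 * exp (- lam * t) * integral {0..t} (\<lambda>s. lam * exp (lam * s) * fbm_cov H s t)
     + (exp (- lam * t))\<^sup>2 * integral {0..t} (\<lambda>s. integral {0..t}
         (\<lambda>u. (lam * exp (lam * s)) * (lam * exp (lam * u)) * fbm_cov H s u))"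

section \<open>Continuity of the covariance and the limit of the incomplete Gamma integral\<close>

lemma continuous_on_abs_powr:
  fixes a :: real
  assumes "0 < a" "continuous_on S f"
  shows "continuous_on S (\<lambda>s. \<bar>f s :: real\<bar> powr a)"
  by (rule continuous_on_powr') (use assms in \<open>auto intro!: continuous_intros\<close>)

lemma continuous_on_fbm_cov:
  assumes "0 < H"
  shows "continuous_on ({0..} \<times> {0..}) (\<lambda>(s, u). fbm_cov H s u)"
proof -
  \<comment> \<open>On the quadrant the added absolute values change nothing; with them every power
    has a nonnegative base and a positive exponent, hence is continuous also where the base is
    0.\<close>
  have "continuous_on ({0..} \<times> {0..})
      (\<lambda>p. (\<bar>snd p\<bar> powr (2 * H) + \<bar>fst p\<bar> powr (2 * H) - \<bar>snd p - fst p\<bar> powr (2 * H)) / 2)"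
    using assms by (intro continuous_intros continuous_on_abs_powr) auto
  then show ?thesis
    by (rule continuous_on_eq) (auto simp: fbm_cov_def)
qed

lemma has_integral_antiderivative:
  fixes F f :: "real \<Rightarrow> real"
  assumes "a \<le> b" "\<And>x. (F has_real_derivative f x) (at x)"
  shows "(f has_integral (F b - F a)) {a..b}"
  by (rule fundamental_theorem_of_calculus[OF assms(1)])
     (use assms(2) in \<open>auto simp: has_real_derivative_iff_has_vector_derivative[symmetric]
        intro: has_field_derivative_at_within\<close>)

text \<open>On the half-line \<open>G\<close> is the lower incomplete Gamma function. The integrand
  of Euler's integral is nonnegative, so its integrability is absolute, and Lebesgue integrals over
  \<open>{0..b}\<close> converge to the one over the half-line.\<close>

lemma incomplete_gamma_tendsto:
  fixes G :: "real \<Rightarrow> real"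
  assumes a: "0 < a" and G0: "G 0 = 0"
    and G: "\<And>s. (G has_real_derivative \<bar>s\<bar> powr a * exp (- s)) (at s)"
  shows "(G \<longlongrightarrow> Gamma (a + 1)) at_top"
proof -
  let ?f = "\<lambda>s::real. s powr a / exp s"
  have f: "(?f has_integral Gamma (a + 1)) {0..}"
    using Gamma_integral_real[of "a + 1"] a by simp
  have "?f absolutely_integrable_on {0..}"
    using f by (intro nonnegative_absolutely_integrable_1) auto
  then have "((\<lambda>b. set_lebesgue_integral lebesgue {0..b} ?f)
      \<longlongrightarrow> set_lebesgue_integral lebesgue {0..} ?f) at_top"
    by (intro tendsto_set_lebesgue_integral_at_top) auto
  moreover have "set_lebesgue_integral lebesgue {0..} ?f = Gamma (a + 1)"
    using \<open>?f absolutely_integrable_on {0..}\<close> f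
    by (simp add: set_lebesgue_integral_eq_integral(2) integral_unique)
  moreover have "\<forall>\<^sub>F b in at_top. set_lebesgue_integral lebesgue {0..b} ?f = G b"
    using eventually_ge_at_top[of 0]
  proof eventually_elim
    case (elim b)
    have "?f absolutely_integrable_on {0..b}"
      using \<open>?f absolutely_integrable_on {0..}\<close> by (rule set_integrable_subset) auto
    moreover have "(?f has_integral (G b - G 0)) {0..b}"
      using has_integral_antiderivative[OF elim G]
      by (rule has_integral_eq[rotated]) (auto simp: exp_minus field_simps)
    ultimately show ?case
      by (simp add: set_lebesgue_integral_eq_integral(2) integral_unique G0)
  qed
  ultimately show ?thesis
    using tendsto_cong by force
qed

text \<open>The absolute values extend the integrands continuously to the whole real line, so that
  the antiderivatives are differentiable everywhere and compose freely with \<open>s \<mapsto> u - s\<close>.\<close>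

locale exp_powr_moments =
  fixes H lam :: real and m n :: "real \<Rightarrow> real"
  assumes H: "0 < H" and lam: "0 < lam"
    and m0: "m 0 = 0" and n0: "n 0 = 0"
    and m': "\<And>s. (m has_real_derivative lam * exp (- lam * s) * \<bar>s\<bar> powr (2 * H)) (at s)"
    and n': "\<And>s. (n has_real_derivative lam * exp (lam * s) * \<bar>s\<bar> powr (2 * H)) (at s)"
begin

section \<open>Closed form of the variance in terms of \<open>m\<close> and \<open>n\<close>\<close>

lemma m_chain [derivative_intros]:
  "(f has_real_derivative f') (at s) \<Longrightarrow>
   ((\<lambda>s. m (f s)) has_real_derivative lam * exp (- lam * f s) * \<bar>f s\<bar> powr (2 * H) * f') (at s)"
  by (rule DERIV_chain2[OF m'])

lemma n_chain [derivative_intros]: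
  "(f has_real_derivative f') (at s) \<Longrightarrow>
   ((\<lambda>s. n (f s)) has_real_derivative lam * exp (lam * f s) * \<bar>f s\<bar> powr (2 * H) * f') (at s)"
  by (rule DERIV_chain2[OF n'])

lemma integral_exp:
  assumes "0 \<le> t"
  shows "((\<lambda>s. lam * exp (lam * s)) has_integral (exp (lam * t) - 1)) {0..t}"
proof -
  have "((\<lambda>s. exp (lam * s)) has_real_derivative lam * exp (lam * s)) (at s)" for s
    by (auto intro!: derivative_eq_intros)
  from has_integral_antiderivative[OF assms this] show ?thesis by simp
qed

lemma integral_exp_powr:
  assumes "0 \<le> t"
  shows "((\<lambda>s. lam * exp (lam * s) * s powr (2 * H)) has_integral n t) {0..t}"
  using has_integral_antiderivative[OF assms n'] n0
  by (auto elim!: has_integral_eq[rotated])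

text \<open>The integral is split at the kink \<open>s = u\<close>. Measuring the distance to
  \<open>u\<close> turns the exponential into \<open>exp (lam * u)\<close> times a decaying factor
  on the left, which gives \<open>m\<close>, and a growing one on the right, which gives
  \<open>n\<close>.\<close>

lemma integral_exp_abs_powr:
  assumes u: "0 \<le> u" "u \<le> t"
  shows "((\<lambda>s. lam * exp (lam * s) * \<bar>u - s\<bar> powr (2 * H)) has_integral
           exp (lam * u) * (m u + n (t - u))) {0..t}"
proof -
  have "((\<lambda>s. - exp (lam * u) * m (u - s)) has_real_derivative
          lam * exp (lam * s) * \<bar>u - s\<bar> powr (2 * H)) (at s)" for s
    by (rule derivative_eq_intros refl)+ (simp add: algebra_simps flip: exp_add)
  from has_integral_antiderivative[OF u(1) this]
  have 1: "((\<lambda>s. lam * exp (lam * s) * \<bar>u - s\<bar> powr (2 * H)) has_integral exp (lam * u) * m u) {0..u}"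
    by (simp add: m0)
  have "((\<lambda>s. exp (lam * u) * n (s - u)) has_real_derivative
          lam * exp (lam * s) * \<bar>u - s\<bar> powr (2 * H)) (at s)" for s
    by (rule derivative_eq_intros refl)+
       (simp add: algebra_simps abs_minus_commute flip: exp_add)
  from has_integral_antiderivative[OF u(2) this]
  have 2: "((\<lambda>s. lam * exp (lam * s) * \<bar>u - s\<bar> powr (2 * H)) has_integral exp (lam * u) * n (t - u)) {u..t}"
    by (simp add: n0)
  show ?thesis
    using has_integral_combine[OF u 1 2] by (simp add: algebra_simps)
qed

text \<open>Integration by parts with \<open>(exp (lam * u))\<^sup>2 / 2\<close> as antiderivative
  of \<open>lam * (exp (lam * u))\<^sup>2\<close>. In \<open>F\<close> the terms
  \<open>- n u\<close> and \<open>- (exp (lam * t))\<^sup>2 * m (t - u)\<close> cancel what arises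
  from differentiating \<open>m u\<close> and \<open>n (t - u)\<close>.\<close>

lemma integral_exp_abs_powr2:
  assumes t: "0 \<le> t"
  shows "((\<lambda>u. lam * exp (lam * u) * (exp (lam * u) * (m u + n (t - u)))) has_integral
           (exp (lam * t))\<^sup>2 * m t - n t) {0..t}"
proof -
  define F where "F u = ((exp (lam * u))\<^sup>2 * m u - n u + (exp (lam * u))\<^sup>2 * n (t - u)
    - (exp (lam * t))\<^sup>2 * m (t - u)) / 2" for u
  \<comment> \<open>Writing all exponentials through \<open>exp (lam * t)\<close> and
    \<open>exp (lam * u)\<close> makes the derivative identity a rational one.\<close>
  have e: "exp (lam * (t - u)) = exp (lam * t) / exp (lam * u)"
    "exp (- lam * (t - u)) = exp (lam * u) / exp (lam * t)"
    "exp (- lam * u) = 1 / exp (lam * u)" for u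
    by (simp_all add: exp_diff right_diff_distrib exp_minus field_simps)
  have "(F has_real_derivative lam * exp (lam * u) * (exp (lam * u) * (m u + n (t - u)))) (at u)" for u
    unfolding F_def
    by (rule derivative_eq_intros refl | simp only: e)+
       (simp add: field_simps power2_eq_square)
  from has_integral_antiderivative[OF t this] show ?thesis
    by (rule has_integral_eq_rhs) (simp add: F_def m0 n0 field_simps)
qed

text \<open>Each of the three terms of the covariance integrates to an expression in
  \<open>m\<close>, \<open>n\<close> and exponentials. In the total the undamped power
  \<open>t powr (2 * H)\<close> and the terms \<open>exp (- lam * t) * n t\<close> cancel, which
  leaves \<open>m t / 2\<close> and two corrections that vanish at infinity.\<close>

lemma fou_var_at_eq:
  assumes t: "0 \<le> t"
  shows "fou_var_at H lam t = exp (- lam * t) * t powr (2 * H) + m t / 2 - (exp (- lam * t))\<^sup>2 * n t / 2"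
proof -
  let ?E = "exp (lam * t)"
  have cross: "((\<lambda>u. lam * exp (lam * u) * fbm_cov H s u) has_integral
      (n t + (?E - 1) * s powr (2 * H) - exp (lam * s) * (m s + n (t - s))) / 2) {0..t}"
    if s: "s \<in> {0..t}" for s
  proof -
    have "((\<lambda>u. (lam * exp (lam * u) * u powr (2 * H) + lam * exp (lam * u) * s powr (2 * H)
        - lam * exp (lam * u) * \<bar>s - u\<bar> powr (2 * H)) / 2) has_integral
      (n t + (?E - 1) * s powr (2 * H) - exp (lam * s) * (m s + n (t - s))) / 2) {0..t}"
      using s t by (intro has_integral_divide has_integral_diff has_integral_add has_integral_mult_left
          integral_exp integral_exp_powr integral_exp_abs_powr) auto
    then show ?thesis
      by (rule has_integral_eq[rotated]) (simp add: fbm_cov_def abs_minus_commute algebra_simps)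
  qed
  have cov_sym: "fbm_cov H s t = fbm_cov H t s" for s
    by (simp add: fbm_cov_def abs_minus_commute)
  \<comment> \<open>The single integral is the inner integral of the double one at
    \<open>s = t\<close>, by symmetry of the covariance and \<open>n 0 = 0\<close>.\<close>
  have single: "integral {0..t} (\<lambda>s. lam * exp (lam * s) * fbm_cov H s t)
      = (n t + (?E - 1) * t powr (2 * H) - ?E * m t) / 2"
    using integral_unique[OF cross[of t]] t by (simp add: cov_sym n0)
  have inner: "integral {0..t} (\<lambda>u. (lam * exp (lam * s)) * (lam * exp (lam * u)) * fbm_cov H s u)
      = (lam * exp (lam * s)) * ((n t + (?E - 1) * s powr (2 * H) - exp (lam * s) * (m s + n (t - s))) / 2)"
    if "s \<in> {0..t}" for s
    using has_integral_mult_right[OF cross[OF that], of "lam * exp (lam * s)"]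
    by (intro integral_unique) (simp add: mult.assoc)
  have "((\<lambda>s. ((lam * exp (lam * s)) * n t + (?E - 1) * (lam * exp (lam * s) * s powr (2 * H))
        - lam * exp (lam * s) * (exp (lam * s) * (m s + n (t - s)))) / 2) has_integral
      ((?E - 1) * n t + (?E - 1) * n t - (?E\<^sup>2 * m t - n t)) / 2) {0..t}"
    using t by (intro has_integral_divide has_integral_diff has_integral_add has_integral_mult_left
        has_integral_mult_right integral_exp integral_exp_powr integral_exp_abs_powr2) auto
  then have "integral {0..t} (\<lambda>s. (lam * exp (lam * s)) * ((n t + (?E - 1) * s powr (2 * H)
        - exp (lam * s) * (m s + n (t - s))) / 2)) = ((?E - 1) * n t + (?E - 1) * n t - (?E\<^sup>2 * m t - n t)) / 2"
    by (intro integral_unique) (simp add: algebra_simps)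
  then have double: "integral {0..t} (\<lambda>s. integral {0..t}
         (\<lambda>u. (lam * exp (lam * s)) * (lam * exp (lam * u)) * fbm_cov H s u))
       = ((?E - 1) * n t + (?E - 1) * n t - (?E\<^sup>2 * m t - n t)) / 2"
    by (simp only: inner cong: integral_cong)
  have "exp (- lam * t) = 1 / ?E"
    by (simp add: exp_minus field_simps)
  then show ?thesis
    unfolding fou_var_at_def single double using t
    by (simp add: fbm_cov_def field_simps power2_eq_square)
qed

text \<open>Bounding the integrand by its value at the right endpoint is crude but enough:
  multiplied by \<open>(exp (- lam * t))\<^sup>2\<close> it still decays exponentially up to a power
  of \<open>t\<close>.\<close>

lemma n_bounds:
  assumes t: "0 \<le> t"
  shows "0 \<le> n t" "n t \<le> lam * exp (lam * t) * t powr (2 * H) * t"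
proof -
  note i = integral_exp_powr[OF t]
  show "0 \<le> n t"
    by (rule has_integral_nonneg[OF i]) (use lam in auto)
  have "((\<lambda>s. lam * exp (lam * t) * t powr (2 * H)) has_integral
      lam * exp (lam * t) * t powr (2 * H) * t) {0..t}"
    using has_integral_const_real[of "lam * exp (lam * t) * t powr (2 * H)" 0 t] t
    by (simp add: mult.commute)
  then show "n t \<le> lam * exp (lam * t) * t powr (2 * H) * t"
    by (rule has_integral_le[OF i])
       (use lam H in \<open>auto intro!: mult_mono powr_mono2\<close>)
qed

lemma fou_var_at_tendsto:
  assumes m: "(m \<longlongrightarrow> lam powr (- 2 * H) * Gamma (2 * H + 1)) at_top"
  shows "(fou_var_at H lam \<longlongrightarrow> fou_variance H lam) at_top"
proof -
  have "((\<lambda>t. (exp (- lam * t))\<^sup>2 * n t) \<longlongrightarrow> 0) at_top"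
  proof (rule tendsto_sandwich[where f = "\<lambda>_. 0"])
    show "((\<lambda>t. (exp (- lam * t))\<^sup>2 * (lam * exp (lam * t) * t powr (2 * H) * t)) \<longlongrightarrow> 0) at_top"
      using lam H by real_asymp
    show "\<forall>\<^sub>F t in at_top. 0 \<le> (exp (- lam * t))\<^sup>2 * n t"
      using eventually_ge_at_top[of 0] by eventually_elim (simp add: n_bounds)
    show "\<forall>\<^sub>F t in at_top. (exp (- lam * t))\<^sup>2 * n t
        \<le> (exp (- lam * t))\<^sup>2 * (lam * exp (lam * t) * t powr (2 * H) * t)"
      using eventually_ge_at_top[of 0] by eventually_elim (intro mult_left_mono n_bounds; simp)
  qed simp
  moreover have "((\<lambda>t. exp (- lam * t) * t powr (2 * H)) \<longlongrightarrow> 0) at_top"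
    using lam H by real_asymp
  ultimately have "((\<lambda>t. exp (- lam * t) * t powr (2 * H) + m t / 2 - (exp (- lam * t))\<^sup>2 * n t / 2)
      \<longlongrightarrow> 0 + lam powr (- 2 * H) * Gamma (2 * H + 1) / 2 - 0 / 2) at_top"
    by (intro tendsto_intros m) auto
  then show ?thesis
    unfolding fou_variance_def
    by (rule Lim_transform_eventually[OF tendsto_eq_rhs])
       (auto intro!: eventually_mono[OF eventually_ge_at_top[of 0]] simp: fou_var_at_eq)
qed

end

lemma fou_variance_tendsto:
  assumes H: "0 < H" and lam: "0 < lam"
  shows "(fou_var_at H lam \<longlongrightarrow> fou_variance H lam) at_top"
proof -
  have "continuous_on UNIV (\<lambda>s::real. \<bar>s\<bar> powr (2 * H) * exp (- s))"
    using H by (intro continuous_intros continuous_on_abs_powr) auto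
  then obtain G where G: "G 0 = 0" "\<And>s. (G has_real_derivative \<bar>s\<bar> powr (2 * H) * exp (- s)) (at s)"
    using antiderivative_real by blast
  have "continuous_on UNIV (\<lambda>s::real. lam * exp (lam * s) * \<bar>s\<bar> powr (2 * H))"
    using H by (intro continuous_intros continuous_on_abs_powr) auto
  then obtain n where n: "n 0 = 0" "\<And>s. (n has_real_derivative lam * exp (lam * s) * \<bar>s\<bar> powr (2 * H)) (at s)"
    using antiderivative_real by blast
  \<comment> \<open>The substitution \<open>s = lam * r\<close> in the Gamma integrand produces the
    factor \<open>lam powr (- 2 * H)\<close>; defining \<open>m\<close> through \<open>G\<close>
    lets its limit be read off from that of \<open>G\<close>.\<close>
  define m where "m t = lam powr (- 2 * H) * G (lam * t)" for t
  interpret exp_powr_moments H lam m n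
  proof
    show "(m has_real_derivative lam * exp (- lam * s) * \<bar>s\<bar> powr (2 * H)) (at s)" for s
    proof -
      have "(m has_real_derivative lam powr (- 2 * H) *
          ((\<bar>lam * s\<bar> powr (2 * H) * exp (- (lam * s))) * lam)) (at s)"
        unfolding m_def
        by (rule derivative_eq_intros DERIV_chain2[OF G(2)] refl | simp)+
      also have "lam powr (- 2 * H) * ((\<bar>lam * s\<bar> powr (2 * H) * exp (- (lam * s))) * lam)
          = lam * exp (- lam * s) * \<bar>s\<bar> powr (2 * H)"
        using lam by (simp add: abs_mult powr_mult powr_minus field_simps)
      finally show ?thesis .
    qed
  qed (use H lam n G in \<open>auto simp: m_def\<close>)
  have "((\<lambda>t. G (lam * t)) \<longlongrightarrow> Gamma (2 * H + 1)) at_top"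
    by (rule filterlim_compose[OF incomplete_gamma_tendsto[OF _ G]])
       (use H lam in \<open>auto intro: filterlim_tendsto_pos_mult_at_top[OF tendsto_const _ filterlim_ident]\<close>)
  then have "(m \<longlongrightarrow> lam powr (- 2 * H) * Gamma (2 * H + 1)) at_top"
    unfolding m_def by (intro tendsto_intros)
  then show ?thesis
    by (rule fou_var_at_tendsto)
qed

section \<open>Law of the Ornstein--Uhlenbeck noise\<close>

lemma char_normal_law:
  assumes v: "0 < v"
  shows "char (normal_law 0 v) \<theta> = of_real (exp (- (\<theta>\<^sup>2 * v) / 2))"
proof -
  have std: "std_normal_distribution = normal_law 0 1"
    by (simp add: normal_law_def)
  have "distr (normal_law 0 1) borel (\<lambda>y. 0 + sqrt v * y) = normal_law (0 + sqrt v * 0) ((sqrt v)\<^sup>2 * 1)"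
    by (rule normal_law_affine)
       (use v in \<open>auto intro!: prob_space_normal_law distr_id2 simp: measurable_ident_sets\<close>)
  then have "normal_law 0 v = distr (normal_law 0 1) borel (\<lambda>y. sqrt v * y)"
    using v by simp
  then have "char (normal_law 0 v) \<theta> = char (normal_law 0 1) (\<theta> * sqrt v)"
    by (simp add: char_def integral_distr mult.assoc)
  also have "\<dots> = of_real (exp (- ((\<theta> * sqrt v)\<^sup>2) / 2))"
    unfolding std[symmetric] char_std_normal_distribution ..
  finally show ?thesis using v by (simp add: power_mult_distrib)
qed

lemma normal_law_moments:
  assumes v: "0 < v"
  shows "(\<integral>y. y \<partial>normal_law a v) = a"
    and "integrable (normal_law a v) (\<lambda>y. y\<^sup>2)"
    and "(\<integral>y. y\<^sup>2 \<partial>normal_law 0 v) = v"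
proof -
  have s: "0 < sqrt v" using v by simp
  show "(\<integral>y. y \<partial>normal_law a v) = a"
    unfolding normal_law_def using integral_normal_moment_nz_1[OF s, of a]
    by (subst integral_density) auto
  show "(\<integral>y. y\<^sup>2 \<partial>normal_law 0 v) = v"
    unfolding normal_law_def using integral_normal_moment_even[OF s, of 0 1] v
    by (subst integral_density) (auto simp: fact_2)
  \<comment> \<open>Here \<open>y\<^sup>2\<close> is decomposed as
    \<open>(y - a)\<^sup>2 + 2 * a * y - a\<^sup>2\<close>, whose pieces are known moments.\<close>
  have "integrable lborel (\<lambda>y. normal_density a (sqrt v) y * (y - a)^2
      + (2 * a) * (normal_density a (sqrt v) y * y) - a\<^sup>2 * normal_density a (sqrt v) y)"
    using s by (intro Bochner_Integration.integrable_add Bochner_Integration.integrable_diff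
        integrable_mult_right integrable_normal_moment integrable_normal_moment_nz_1
        integrable_normal_density)
  then have "integrable lborel (\<lambda>y. normal_density a (sqrt v) y * y\<^sup>2)"
    by (simp add: power2_eq_square algebra_simps)
  then show "integrable (normal_law a v) (\<lambda>y. y\<^sup>2)"
    unfolding normal_law_def by (subst integrable_density) auto
qed

lemma (in prob_space) gaussian_law_square_integrable:
  assumes X [measurable]: "X \<in> borel_measurable M" and g: "gaussian_law (distr M borel X)"
  shows "integrable M (\<lambda>\<omega>. (X \<omega>)\<^sup>2)"
proof -
  have "integrable (distr M borel X) (\<lambda>y. y\<^sup>2)"
    using g unfolding gaussian_law_def
  proof (elim exE disjE conjE)
    fix a assume "distr M borel X = return borel a"
    then show ?thesis by (simp add: integrable_iff_bounded nn_integral_return)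
  qed (simp add: normal_law_moments)
  then show ?thesis by (subst (asm) integrable_distr_eq) auto
qed

text \<open>A point mass with mean 0 sits at 0 and fits the same formula with variance 0, so the
  approximating Riemann sums can be treated without asking whether they are degenerate.\<close>

lemma (in prob_space) char_centered_gaussian:
  assumes X [measurable]: "X \<in> borel_measurable M" and g: "gaussian_law (distr M borel X)"
    and mean: "(\<integral>\<omega>. X \<omega> \<partial>M) = 0"
  shows "char (distr M borel X) \<theta> = of_real (exp (- (\<theta>\<^sup>2 * (\<integral>\<omega>. (X \<omega>)\<^sup>2 \<partial>M)) / 2))"
proof -
  let ?D = "distr M borel X"
  have 1: "(\<integral>y. y \<partial>?D) = 0" using mean by (subst integral_distr) auto
  have 2: "(\<integral>\<omega>. (X \<omega>)\<^sup>2 \<partial>M) = (\<integral>y. y\<^sup>2 \<partial>?D)" by (subst integral_distr) auto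
  show ?thesis
    using g unfolding gaussian_law_def 2
  proof (elim exE disjE conjE)
    fix a assume D: "?D = return borel a"
    with 1 have "a = 0" by (simp add: integral_return)
    then show "char ?D \<theta> = of_real (exp (- (\<theta>\<^sup>2 * (\<integral>y. y\<^sup>2 \<partial>?D)) / 2))"
      unfolding D by (simp add: char_def integral_return)
  next
    fix a v assume v: "0 < v" and D: "?D = normal_law a v"
    with 1 have "a = 0" by (simp add: normal_law_moments)
    then show "char ?D \<theta> = of_real (exp (- (\<theta>\<^sup>2 * (\<integral>y. y\<^sup>2 \<partial>?D)) / 2))"
      unfolding D using v by (simp add: char_normal_law normal_law_moments)
  qed
qed

text \<open>The characteristic functions have two limits: that of \<open>Z\<close>, by dominated
  convergence with bound 1, and that of \<open>normal_law 0 v\<close>, by convergence of the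
  variances. Levy's uniqueness theorem identifies the laws.\<close>

lemma (in prob_space) normal_law_limit:
  fixes Y :: "nat \<Rightarrow> 'a \<Rightarrow> real"
  assumes Y [measurable]: "\<And>n. Y n \<in> borel_measurable M"
    and g: "\<And>n. gaussian_law (distr M borel (Y n))"
    and mean: "\<And>n. (\<integral>\<omega>. Y n \<omega> \<partial>M) = 0"
    and var: "(\<lambda>n. \<integral>\<omega>. (Y n \<omega>)\<^sup>2 \<partial>M) \<longlonglongrightarrow> v" and v: "0 < v"
    and lim: "\<And>\<omega>. \<omega> \<in> space M \<Longrightarrow> (\<lambda>n. Y n \<omega>) \<longlonglongrightarrow> Z \<omega>"
  shows "Z \<in> borel_measurable M" "distr M borel Z = normal_law 0 v"
proof -
  show Z [measurable]: "Z \<in> borel_measurable M"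
    using lim by (rule borel_measurable_LIMSEQ_real) auto
  show "distr M borel Z = normal_law 0 v"
  proof (rule Levy_uniqueness)
    show "real_distribution (distr M borel Z)" by simp
    show "real_distribution (normal_law 0 v)"
      using prob_space_normal_law[OF v]
      by (simp add: real_distribution_def real_distribution_axioms_def)
    show "char (distr M borel Z) = char (normal_law 0 v)"
    proof (rule ext)
      fix \<theta>
      have ch: "char (distr M borel X) \<theta> = (\<integral>\<omega>. iexp (\<theta> * X \<omega>) \<partial>M)"
        if [measurable]: "X \<in> borel_measurable M" for X
        by (simp add: char_def integral_distr)
      have "(\<lambda>n. \<integral>\<omega>. iexp (\<theta> * Y n \<omega>) \<partial>M) \<longlonglongrightarrow> (\<integral>\<omega>. iexp (\<theta> * Z \<omega>) \<partial>M)"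
        by (rule integral_dominated_convergence[where w = "\<lambda>_. 1"])
           (auto intro!: tendsto_intros lim)
      then have "(\<lambda>n. char (distr M borel (Y n)) \<theta>) \<longlonglongrightarrow> char (distr M borel Z) \<theta>"
        by (simp add: ch)
      moreover have "(\<lambda>n. char (distr M borel (Y n)) \<theta>) \<longlonglongrightarrow> char (normal_law 0 v) \<theta>"
        unfolding char_centered_gaussian[OF Y g mean] char_normal_law[OF v]
        by (intro tendsto_intros var) auto
      ultimately show "char (distr M borel Z) \<theta> = char (normal_law 0 v) \<theta>"
        by (rule LIMSEQ_unique)
    qed
  qed
qed

section \<open>Finite combinations of fractional Brownian motion and the law of the noise\<close>

locale fbm = prob_space M for M :: "'a measure" and H :: real and B :: "real \<Rightarrow> 'a \<Rightarrow> real" +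
  assumes H: "0 < H" and fbm: "fractional_brownian_motion M H B"
begin

lemma B_measurable [measurable]: "0 \<le> t \<Longrightarrow> B t \<in> borel_measurable M"
  using fbm by (auto simp: fractional_brownian_motion_def gaussian_process_def)

lemma B_combination_gaussian:
  "finite F \<Longrightarrow> F \<subseteq> {0..} \<Longrightarrow> gaussian_law (distr M borel (\<lambda>\<omega>. \<Sum>t\<in>F. c t * B t \<omega>))"
  using fbm by (auto simp: fractional_brownian_motion_def gaussian_process_def)

lemma B_square_integrable:
  assumes "0 \<le> t"
  shows "integrable M (\<lambda>\<omega>. (B t \<omega>)\<^sup>2)"
  using gaussian_law_square_integrable[OF B_measurable[OF assms]]
    B_combination_gaussian[of "{t}" "\<lambda>_. 1"] assms by simp

lemma B_integrable: "0 \<le> t \<Longrightarrow> integrable M (B t)"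
  by (rule square_integrable_imp_integrable[OF B_measurable B_square_integrable])

lemma B_product_integrable:
  assumes "0 \<le> s" "0 \<le> t"
  shows "integrable M (\<lambda>\<omega>. B s \<omega> * B t \<omega>)"
proof (rule Bochner_Integration.integrable_bound)
  show "integrable M (\<lambda>\<omega>. (B s \<omega>)\<^sup>2 + (B t \<omega>)\<^sup>2)"
    using assms by (intro Bochner_Integration.integrable_add B_square_integrable)
  show "AE \<omega> in M. norm (B s \<omega> * B t \<omega>) \<le> norm ((B s \<omega>)\<^sup>2 + (B t \<omega>)\<^sup>2)"
  proof (rule AE_I2)
    fix \<omega>
    have "2 * (\<bar>B s \<omega>\<bar> * \<bar>B t \<omega>\<bar>) \<le> (B s \<omega>)\<^sup>2 + (B t \<omega>)\<^sup>2"
      using sum_squares_bound[of "\<bar>B s \<omega>\<bar>" "\<bar>B t \<omega>\<bar>"] by simp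
    moreover have "0 \<le> \<bar>B s \<omega>\<bar> * \<bar>B t \<omega>\<bar>" by simp
    ultimately show "norm (B s \<omega> * B t \<omega>) \<le> norm ((B s \<omega>)\<^sup>2 + (B t \<omega>)\<^sup>2)"
      unfolding real_norm_def abs_mult by linarith
  qed
qed (use assms in measurable)

lemma B_combination_moments:
  assumes F: "finite F" "F \<subseteq> {0..}"
  shows "(\<integral>\<omega>. (\<Sum>t\<in>F. c t * B t \<omega>) \<partial>M) = 0"
    and "(\<integral>\<omega>. (\<Sum>t\<in>F. c t * B t \<omega>)\<^sup>2 \<partial>M) = (\<Sum>s\<in>F. c s * (\<Sum>u\<in>F. c u * fbm_cov H s u))"
proof -
  have mean: "(\<integral>\<omega>. B t \<omega> \<partial>M) = 0" if "0 \<le> t" for t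
    using fbm that by (auto simp: fractional_brownian_motion_def)
  have cov: "(\<integral>\<omega>. B s \<omega> * B t \<omega> \<partial>M) = fbm_cov H s t" if "0 \<le> s" "0 \<le> t" for s t
    using fbm that by (auto simp: fractional_brownian_motion_def fbm_cov_def)
  have pos: "0 \<le> t" if "t \<in> F" for t using F that by auto
  show "(\<integral>\<omega>. (\<Sum>t\<in>F. c t * B t \<omega>) \<partial>M) = 0"
    using pos by (subst Bochner_Integration.integral_sum) (auto simp: mean B_integrable)
  have "(\<integral>\<omega>. (\<Sum>t\<in>F. c t * B t \<omega>)\<^sup>2 \<partial>M) = (\<integral>\<omega>. (\<Sum>s\<in>F. \<Sum>u\<in>F. (c s * c u) * (B s \<omega> * B u \<omega>)) \<partial>M)"
    by (simp add: power2_eq_square sum_product mult_ac)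
  also have "\<dots> = (\<Sum>s\<in>F. \<Sum>u\<in>F. (c s * c u) * fbm_cov H s u)"
    using pos by (simp add: Bochner_Integration.integral_sum Bochner_Integration.integrable_sum
        cov B_product_integrable)
  finally show "(\<integral>\<omega>. (\<Sum>t\<in>F. c t * B t \<omega>)\<^sup>2 \<partial>M) = (\<Sum>s\<in>F. c s * (\<Sum>u\<in>F. c u * fbm_cov H s u))"
    by (simp add: sum_distrib_left mult_ac)
qed

lemma fou_noise_law:
  assumes t: "0 < t" and pos: "0 < fou_var_at H lam t"
  defines "Z \<equiv> \<lambda>\<omega>. exp (- lam * t) * exp_path_integral lam (\<lambda>s. B s \<omega>) t"
  shows "Z \<in> borel_measurable M" "distr M borel Z = normal_law 0 (fou_var_at H lam t)"
proof -
  define e where "e = exp (- lam * t)"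
  define h where "h n = t / real (Suc n)" for n
  \<comment> \<open>The time \<open>t\<close> carries the term \<open>B t\<close> with weight 1, the
    grid points carry the Riemann sum. The grid uses left endpoints and stays strictly below
    \<open>t\<close>, so the case distinction in \<open>c\<close> never conflicts.\<close>
  define F where "F n = insert t ((\<lambda>k. h n * real k) ` {..<Suc n})" for n
  define c where "c n s = (if s = t then 1 else - e * h n * (lam * exp (lam * s)))" for n s
  define Y where "Y n \<omega> = (\<Sum>s\<in>F n. c n s * B s \<omega>)" for n \<omega>
  have h: "0 < h n" for n using t by (simp add: h_def)
  have ht: "h n * real k < t" if "k < Suc n" for n k
  proof -
    have "h n * real k < h n * real (Suc n)"
      using that h by (intro mult_strict_left_mono) auto
    then show ?thesis by (simp add: h_def del: of_nat_Suc)
  qed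
  have F: "finite (F n)" "F n \<subseteq> {0..}" for n
    using t h[of n] by (auto simp: F_def)
  \<comment> \<open>Kept general in \<open>g\<close>: it is used with a path of \<open>B\<close> for
    the limit, and once in each variable of the covariance for the variance.\<close>
  have sumF: "(\<Sum>s\<in>F n. c n s * g s)
      = g t - e * (h n * (\<Sum>k<Suc n. lam * exp (lam * (h n * real k)) * g (h n * real k)))"
    for n and g :: "real \<Rightarrow> real"
  proof -
    have "(\<Sum>s\<in>F n. c n s * g s) = c n t * g t + (\<Sum>s\<in>(\<lambda>k. h n * real k) ` {..<Suc n}. c n s * g s)"
      unfolding F_def using ht[of _ n] by (subst sum.insert) force+
    also have "(\<Sum>s\<in>(\<lambda>k. h n * real k) ` {..<Suc n}. c n s * g s)
        = (\<Sum>k<Suc n. c n (h n * real k) * g (h n * real k))"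
      using h[of n] by (subst sum.reindex) (auto simp: inj_on_def)
    also have "\<dots> = (\<Sum>k<Suc n. - e * h n * (lam * exp (lam * (h n * real k)) * g (h n * real k)))"
      using ht[of _ n] by (intro sum.cong refl) (auto simp: c_def mult_ac)
    also have "\<dots> = - e * h n * (\<Sum>k<Suc n. lam * exp (lam * (h n * real k)) * g (h n * real k))"
      by (simp only: sum_distrib_left)
    finally show ?thesis by (simp add: c_def)
  qed
  have Ym [measurable]: "Y n \<in> borel_measurable M" for n
    unfolding Y_def using F[of n] by (intro borel_measurable_sum borel_measurable_times) auto
  have Yg: "gaussian_law (distr M borel (Y n))" for n
    unfolding Y_def by (rule B_combination_gaussian[OF F])
  have Y0: "(\<integral>\<omega>. Y n \<omega> \<partial>M) = 0" for n
    unfolding Y_def by (rule B_combination_moments(1)[OF F])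
  have cov_cont: "continuous_on ({0..t} \<times> {0..t}) (\<lambda>(s, u). fbm_cov H s u)"
    by (rule continuous_on_subset[OF continuous_on_fbm_cov[OF H]]) auto
  have cov_sym: "fbm_cov H s u = fbm_cov H u s" for s u
    by (simp add: fbm_cov_def abs_minus_commute)
  let ?K = "\<lambda>(s, u). (lam * exp (lam * s)) * (lam * exp (lam * u)) * fbm_cov H s u"
  define S1 where "S1 n = h n * (\<Sum>k<Suc n. lam * exp (lam * (h n * real k)) * fbm_cov H (h n * real k) t)" for n
  define S2 where "S2 n = h n * (\<Sum>i<Suc n. h n * (\<Sum>j<Suc n. ?K (h n * real i, h n * real j)))" for n
  have var: "(\<integral>\<omega>. (Y n \<omega>)\<^sup>2 \<partial>M) = fbm_cov H t t - 2 * e * S1 n + e\<^sup>2 * S2 n" for n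
  proof -
    let ?a = "\<lambda>k. lam * exp (lam * (h n * real k))" and ?s = "\<lambda>k. h n * real k"
    \<comment> \<open>\<open>G s\<close> is the covariance of \<open>B s\<close> with
      \<open>Y n\<close>; summing it against the same weights gives the variance of
      \<open>Y n\<close>.\<close>
    define G where "G s = fbm_cov H s t - e * (h n * (\<Sum>j<Suc n. ?a j * fbm_cov H s (?s j)))" for s
    have "(\<integral>\<omega>. (Y n \<omega>)\<^sup>2 \<partial>M) = (\<Sum>s\<in>F n. c n s * G s)"
      unfolding Y_def B_combination_moments(2)[OF F] G_def by (simp only: sumF)
    also have "\<dots> = G t - e * (h n * (\<Sum>i<Suc n. ?a i * G (?s i)))"
      by (rule sumF)
    also have "G t = fbm_cov H t t - e * S1 n"
      unfolding G_def S1_def by (simp only: cov_sym[of t "h n * _"])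
    also have "h n * (\<Sum>i<Suc n. ?a i * G (?s i)) = S1 n - e * S2 n"
      unfolding G_def S1_def S2_def
      by (simp only: right_diff_distrib sum_subtractf sum_distrib_left prod.case ac_simps)
    finally show ?thesis by (simp add: algebra_simps power2_eq_square)
  qed
  have "S1 \<longlonglongrightarrow> integral {0..t} (\<lambda>s. lam * exp (lam * s) * fbm_cov H s t)"
    unfolding S1_def h_def
  proof (rule riemann_sum_tendsto_integral[OF t])
    have "continuous_on {0..t} (\<lambda>s. (\<lambda>(s, u). fbm_cov H s u) (s, t))"
      by (rule continuous_on_compose2[OF cov_cont]) (use t in \<open>auto intro!: continuous_intros\<close>)
    then show "continuous_on {0..t} (\<lambda>s. lam * exp (lam * s) * fbm_cov H s t)"
      by (intro continuous_intros) simp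
  qed
  moreover have "S2 \<longlonglongrightarrow> integral {0..t} (\<lambda>s. integral {0..t} (\<lambda>u. ?K (s, u)))"
    unfolding S2_def h_def
  proof (rule riemann_sum_tendsto_integral2[OF t])
    have "continuous_on ({0..t} \<times> {0..t})
        (\<lambda>p. lam * exp (lam * fst p) * (lam * exp (lam * snd p)) * (\<lambda>(s, u). fbm_cov H s u) p)"
      by (intro continuous_intros cov_cont)
    then show "continuous_on ({0..t} \<times> {0..t}) ?K"
      by (simp add: case_prod_beta)
  qed
  ultimately have var_lim: "(\<lambda>n. \<integral>\<omega>. (Y n \<omega>)\<^sup>2 \<partial>M) \<longlonglongrightarrow> fou_var_at H lam t"
    unfolding var fou_var_at_def e_def[symmetric] prod.case by (intro tendsto_intros)
  have path: "(\<lambda>n. Y n \<omega>) \<longlonglongrightarrow> Z \<omega>" if \<omega>: "\<omega> \<in> space M" for \<omega>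
  proof -
    have "continuous_on {0..} (\<lambda>s. B s \<omega>)"
      using fbm \<omega> by (auto simp: fractional_brownian_motion_def)
    then have "continuous_on {0..t} (\<lambda>s. B s \<omega>)"
      by (rule continuous_on_subset) auto
    then have "continuous_on {0..t} (\<lambda>s. lam * exp (lam * s) * B s \<omega>)"
      by (intro continuous_intros)
    from riemann_sum_tendsto_integral[OF t this]
    have "(\<lambda>n. B t \<omega> - e * (h n * (\<Sum>k<Suc n. lam * exp (lam * (h n * real k)) * B (h n * real k) \<omega>)))
        \<longlonglongrightarrow> B t \<omega> - e * integral {0..t} (\<lambda>s. lam * exp (lam * s) * B s \<omega>)"
      unfolding h_def by (intro tendsto_intros)
    \<comment> \<open>The factor \<open>exp (- lam * t)\<close> cancels \<open>exp (lam * t)\<close>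
      in the boundary term of the integration by parts, leaving \<open>B t\<close> with weight
      1.\<close>
    also have "B t \<omega> - e * integral {0..t} (\<lambda>s. lam * exp (lam * s) * B s \<omega>) = Z \<omega>"
      by (simp add: Z_def exp_path_integral_def e_def mult.assoc right_diff_distrib exp_minus)
    finally show ?thesis unfolding Y_def sumF .
  qed
  show "Z \<in> borel_measurable M" "distr M borel Z = normal_law 0 (fou_var_at H lam t)"
    using normal_law_limit[OF Ym Yg Y0 var_lim pos path] by auto
qed

end

section \<open>Cutoff\<close>

theorem theorem2p2:
  fixes H lam x w :: real
    and M :: "'a measure" and B :: "real \<Rightarrow> 'a \<Rightarrow> real"
    and N :: "real \<Rightarrow> 'b measure" and Xinf :: "real \<Rightarrow> 'b \<Rightarrow> real"
    and w' :: "real \<Rightarrow> real"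
  assumes "0 < H" and "H < 1" and "0 < lam" and "x \<noteq> 0"
    and "prob_space M"
    and "fractional_brownian_motion M H B"
    and "\<And>\<epsilon>. 0 < \<epsilon> \<Longrightarrow> prob_space (N \<epsilon>)"
    and "\<And>\<epsilon>. 0 < \<epsilon> \<Longrightarrow> Xinf \<epsilon> \<in> borel_measurable (N \<epsilon>)"
    and "\<And>\<epsilon>. 0 < \<epsilon> \<Longrightarrow>
           distr (N \<epsilon>) borel (Xinf \<epsilon>) = normal_law 0 (\<epsilon>\<^sup>2 * fou_variance H lam)"
    and "(w' \<longlongrightarrow> w) (at_right 0)" and "0 < w"
  shows "(\<forall>r. ((\<lambda>\<epsilon>. tv_dist
                  (distr M borel (fractional_OU lam B x \<epsilon> (cutoff_time lam \<epsilon> + r * w' \<epsilon>)))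
                  (distr (N \<epsilon>) borel (Xinf \<epsilon>)))
               \<longlongrightarrow> tv_profile H lam x w r) (at_right 0))
       \<and> (tv_profile H lam x w \<longlongrightarrow> 1) at_bot
       \<and> (tv_profile H lam x w \<longlongrightarrow> 0) at_top"
proof (intro conjI allI)
  note lam = \<open>0 < lam\<close> and w = \<open>0 < w\<close> and w' = \<open>(w' \<longlongrightarrow> w) (at_right 0)\<close>
  interpret fbm M H B
    using assms by (auto simp: fbm_def fbm_axioms_def)
  let ?R = "fou_variance H lam"
  have R: "0 < ?R"
    unfolding fou_variance_def using lam H by (auto intro!: mult_pos_pos Gamma_real_pos)
  have scale: "distr (normal_law a v) borel (\<lambda>y. \<epsilon> * y) = normal_law (\<epsilon> * a) (\<epsilon>\<^sup>2 * v)"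
    if "0 < v" "0 < \<epsilon>" for a v \<epsilon>
  proof -
    have "distr (normal_law a v) borel (\<lambda>y. 0 + \<epsilon> * y) = normal_law (0 + \<epsilon> * a) (\<epsilon>\<^sup>2 * v)"
      by (rule normal_law_affine)
         (use that in \<open>auto intro!: prob_space_normal_law distr_id2 simp: measurable_ident_sets\<close>)
    then show ?thesis by simp
  qed
  show "((\<lambda>\<epsilon>. tv_dist
            (distr M borel (fractional_OU lam B x \<epsilon> (cutoff_time lam \<epsilon> + r * w' \<epsilon>)))
            (distr (N \<epsilon>) borel (Xinf \<epsilon>))) \<longlongrightarrow> tv_profile H lam x w r) (at_right 0)" for r
  proof -
    define T where "T \<epsilon> = cutoff_time lam \<epsilon> + r * w' \<epsilon>" for \<epsilon>
    have "filterlim (cutoff_time lam) at_top (at_right 0)"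
      unfolding cutoff_time_def using lam by real_asymp
    moreover have "((\<lambda>\<epsilon>. r * w' \<epsilon>) \<longlongrightarrow> r * w) (at_right 0)"
      by (intro tendsto_intros w')
    ultimately have T: "filterlim T at_top (at_right 0)"
      unfolding T_def add.commute[of "cutoff_time lam _"]
      by (intro filterlim_tendsto_add_at_top)
    have var: "((\<lambda>\<epsilon>. fou_var_at H lam (T \<epsilon>)) \<longlongrightarrow> ?R) (at_right 0)"
      by (rule filterlim_compose[OF fou_variance_tendsto[OF H lam] T])
    have mean: "((\<lambda>\<epsilon>. exp (- lam * r * w' \<epsilon>) * x) \<longlongrightarrow> exp (- lam * r * w) * x) (at_right 0)"
      by (intro tendsto_intros w')
    have "\<forall>\<^sub>F \<epsilon> in at_right (0::real). 0 < \<epsilon>"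
      by (rule eventually_at_right_less)
    moreover have "\<forall>\<^sub>F \<epsilon> in at_right 0. 0 < T \<epsilon>"
      using T by (rule filterlim_at_top_dense[THEN iffD1, THEN spec])
    \<comment> \<open>\<open>normal_law\<close> requires a positive variance; since the variances
      tend to \<open>?R > 0\<close>, this holds for all small \<open>\<epsilon>\<close>.\<close>
    moreover have "\<forall>\<^sub>F \<epsilon> in at_right 0. 0 < fou_var_at H lam (T \<epsilon>)"
      using order_tendstoD(1)[OF var R] .
    ultimately have "\<forall>\<^sub>F \<epsilon> in at_right 0.
        tv_dist (normal_law (exp (- lam * r * w' \<epsilon>) * x) (fou_var_at H lam (T \<epsilon>))) (normal_law 0 ?R)
        = tv_dist (distr M borel (fractional_OU lam B x \<epsilon> (T \<epsilon>))) (distr (N \<epsilon>) borel (Xinf \<epsilon>))"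
    proof eventually_elim
      case (elim \<epsilon>)
      let ?v = "fou_var_at H lam (T \<epsilon>)" and ?a = "exp (- lam * r * w' \<epsilon>) * x"
      \<comment> \<open>At the cutoff time the deterministic decay equals the noise amplitude
        \<open>\<epsilon>\<close>; the shift \<open>r * w' \<epsilon>\<close> contributes only the
        remaining exponential.\<close>
      have e: "exp (- lam * T \<epsilon>) = \<epsilon> * exp (- lam * r * w' \<epsilon>)"
      proof -
        have "- lam * T \<epsilon> = ln \<epsilon> + - lam * r * w' \<epsilon>"
          using lam elim(1) by (simp add: T_def cutoff_time_def ln_div algebra_simps)
        then show ?thesis using elim(1) by (simp only: exp_add exp_ln)
      qed
      \<comment> \<open>The process at time \<open>T \<epsilon>\<close> is \<open>\<epsilon>\<close>
        times the sum of \<open>?a\<close> and the noise, and the limit law is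
        \<open>\<epsilon>\<close> times \<open>normal_law 0 ?R\<close>, so scale invariance removes
        \<open>\<epsilon>\<close> from both.\<close>
      have "distr M borel (\<lambda>\<omega>. \<epsilon> * ?a + \<epsilon> * (exp (- lam * T \<epsilon>) * exp_path_integral lam (\<lambda>s. B s \<omega>) (T \<epsilon>)))
          = normal_law (\<epsilon> * ?a + \<epsilon> * 0) (\<epsilon>\<^sup>2 * ?v)"
        by (rule normal_law_affine[OF fou_noise_law(1) prob_space_axioms _ _ fou_noise_law(2)])
           (use elim in auto)
      also have "(\<lambda>\<omega>. \<epsilon> * ?a + \<epsilon> * (exp (- lam * T \<epsilon>) * exp_path_integral lam (\<lambda>s. B s \<omega>) (T \<epsilon>)))
          = fractional_OU lam B x \<epsilon> (T \<epsilon>)"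
        unfolding fractional_OU_def e by (simp add: fun_eq_iff mult_ac)
      finally have X: "distr M borel (fractional_OU lam B x \<epsilon> (T \<epsilon>))
          = distr (normal_law ?a ?v) borel (\<lambda>y. \<epsilon> * y)"
        using elim by (simp add: scale)
      have "distr (N \<epsilon>) borel (Xinf \<epsilon>) = distr (normal_law 0 ?R) borel (\<lambda>y. \<epsilon> * y)"
        using assms(9)[of \<epsilon>] elim R by (simp add: scale)
      with X show ?case
        using elim by (simp add: tv_dist_scale)
    qed
    with tv_dist_normal_tendsto[OF mean var R R, of 0] show ?thesis
      unfolding T_def tv_profile_def by (rule Lim_transform_eventually)
  qed
  have "((\<lambda>r. exp (- lam * r * w) * x) \<longlongrightarrow> 0) at_top"
    using lam w by real_asymp
  from tv_dist_normal_tendsto[OF this tendsto_const R R, of 0]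
  have "(tv_profile H lam x w \<longlongrightarrow> tv_dist (normal_law 0 ?R) (normal_law 0 ?R)) at_top"
    unfolding tv_profile_def .
  then show "(tv_profile H lam x w \<longlongrightarrow> 0) at_top"
    by simp
  have "filterlim (\<lambda>r. exp (- lam * r * w)) at_top at_bot"
    using lam w by real_asymp
  \<comment> \<open>As \<open>x \<noteq> 0\<close>, the growing exponential pushes the mean to
    infinity in absolute value, and the two laws separate.\<close>
  then have "filterlim (\<lambda>r. \<bar>x\<bar> * exp (- lam * r * w)) at_top at_bot"
    using \<open>x \<noteq> 0\<close> by (intro filterlim_tendsto_pos_mult_at_top[OF tendsto_const]) auto
  then have "filterlim (\<lambda>r. \<bar>exp (- lam * r * w) * x\<bar>) at_top at_bot"
    by (simp add: abs_mult mult.commute)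
  from tv_dist_normal_tendsto_1[OF this R]
  show "(tv_profile H lam x w \<longlongrightarrow> 1) at_bot"
    unfolding tv_profile_def .
qed

end
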